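(* Let $n\geq 8$ and $a$ be integers with $2\leq a<\frac{n}{2}$ and $(n,a)\neq(8,3)$, and let $\overline{\Gamma}=\overline{C_n(1,a)}$ be the complement of the circulant graph $C_n(1,a)$. Then its distance spectral radius is $$\rho(\overline{\Gamma})=n+3.$$
   Context: For $S\subseteq\mathbb{Z}_n\setminus\{0\}$, the circulant graph $C_n(S)$ is the simple undirected graph with vertex set $\mathbb{Z}_n=\{0,1,\ldots,n-1\}$ and edge set $\{\{g,g+s\}: g\in\mathbb{Z}_n, s\in S\}$ (addition mod $n$); $C_n(1,a)$ means $C_n(\{1,a\})$. $\overline{\Gamma}$ denotes the complement of $\Gamma$. For a connected graph $\Gamma$ with vertices $v_1,\ldots,v_n$, the distance matrix $\mathbf{D}(\Gamma)$ is the $n\times n$ matrix with $(i,j)$-entry $d_{\Gamma}(v_i,v_j)$, the length of a shortest path between $v_i$ and $v_j$ ($0$ if $i=j$). The distance spectral radius $\rho(\Gamma)$ is the largest eigenvalue of $\mathbf{D}(\Gamma)$. *)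

theory Defs
  imports
    "Graph_Theory.Graph_Theory"
    "Jordan_Normal_Form.Spectral_Radius"
begin

text \<open>
  As usual in \<^theory>\<open>Graph_Theory.Graph_Theory\<close>, a simple undirected graph is a finite, symmetric,
  loop-free digraph whose arcs are pairs of vertices (locale \<^locale>\<open>pair_graph\<close>): the edge
  $\{u,v\}$ is the pair of arcs $(u,v)$, $(v,u)$. The group $\mathbb{Z}_n$ is represented by
  \<^term>\<open>{0..<n}\<close> with addition modulo \<^term>\<open>n\<close>; connection sets are meant to satisfy
  \<^term>\<open>S \<subseteq> {1..<n}\<close>.
\<close>

definition circulant_edges :: "nat \<Rightarrow> nat set \<Rightarrow> nat set set" where
  "circulant_edges n S = {{g, (g + s) mod n} | g s. g \<in> {0..<n} \<and> s \<in> S}"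

definition circulant_graph :: "nat \<Rightarrow> nat set \<Rightarrow> nat pair_pre_digraph" where
  "circulant_graph n S =
     \<lparr> pverts = {0..<n}, parcs = {(u, v). {u, v} \<in> circulant_edges n S} \<rparr>"

definition complement_graph :: "'a pair_pre_digraph \<Rightarrow> 'a pair_pre_digraph" where
  "complement_graph G =
     \<lparr> pverts = pverts G,
       parcs = {(u, v). u \<in> pverts G \<and> v \<in> pverts G \<and> u \<noteq> v \<and> (u, v) \<notin> parcs G} \<rparr>"

text \<open>
  The length of a shortest path. This is only meaningful if some path exists; otherwise
  the result is an unspecified number.
\<close>

definition graph_distance :: "'a pair_pre_digraph \<Rightarrow> 'a \<Rightarrow> 'a \<Rightarrow> nat" where
  "graph_distance G u v =
     (LEAST k. \<exists>p. pre_digraph.apath (with_proj G) u p v \<and> length p = k)"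

text \<open>The vertices $v_1, \dots, v_n$ are enumerated in increasing order.\<close>

definition distance_matrix :: "'a :: linorder pair_pre_digraph \<Rightarrow> real mat" where
  "distance_matrix G =
     (let vs = sorted_list_of_set (pverts G) in
        mat (length vs) (length vs) (\<lambda>(i, j). real (graph_distance G (vs ! i) (vs ! j))))"

text \<open>
  The distance matrix of a graph is real symmetric, so all its eigenvalues are real and
  nothing is lost by taking the spectrum over the reals.
\<close>

definition distance_spectral_radius :: "'a :: linorder pair_pre_digraph \<Rightarrow> real" where
  "distance_spectral_radius G = Max (spectrum (distance_matrix G))"

lemma circulant_graph_pair_graph:
  assumes "S \<subseteq> {1..<n}"
  shows "pair_graph (circulant_graph n S)"
proof -
  have shift: "(g + s) mod n \<noteq> g" if "g < n" "s \<in> S" for g s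
  proof
    assume eq: "(g + s) mod n = g"
    have "0 < s" "s < n"
      using that assms by auto
    with eq \<open>g < n\<close> show False
      by (cases "g + s < n") (auto simp: le_mod_geq not_less)
  qed
  have sub: "parcs (circulant_graph n S) \<subseteq> {0..<n} \<times> {0..<n}"
    by (auto simp: circulant_graph_def circulant_edges_def doubleton_eq_iff)
  then have "finite (parcs (circulant_graph n S))"
    by (rule finite_subset) simp
  moreover have "symmetric (with_proj (circulant_graph n S))"
    by (auto simp: symmetric_def circulant_graph_def insert_commute intro!: symI)
  moreover have "u \<noteq> v" if "(u, v) \<in> parcs (circulant_graph n S)" for u v
    using that
    by (auto simp: circulant_graph_def circulant_edges_def doubleton_eq_iff
        dest: shift shift[symmetric])
  ultimately show ?thesis
    using sub
    by unfold_locales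
      (simp_all add: circulant_graph_def subset_iff split_paired_all)
qed

lemma complement_graph_pair_graph:
  assumes "pair_graph G"
  shows "pair_graph (complement_graph G)"
proof -
  interpret pair_graph G by fact
  have sub: "parcs (complement_graph G) \<subseteq> pverts G \<times> pverts G"
    by (auto simp: complement_graph_def)
  then have "finite (parcs (complement_graph G))"
    by (rule finite_subset) simp
  with sub show ?thesis
    by unfold_locales
      (auto simp: complement_graph_def symmetric_def intro!: symI dest: arcs_symmetric)
qed

end

theory Submission
  imports Defs
begin

text \<open>
  The sum of a row of the distance matrix is the sum of the distances from one vertex. If all row
  sums of a nonnegative matrix equal $r$, then the all-ones vector is an eigenvector for $r$, and
  comparing entries at an index where an eigenvector is largest in absolute value shows that no
  eigenvalue exceeds $r$ (lemma \<open>Max_spectrum_eq_row_sum\<close>). So the distance spectral radius of a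
  graph is the common sum of distances as soon as this sum is the same for all vertices.

  Let $G$ be $k$-regular on $n$ vertices, and suppose that the endpoints of every edge of $G$ have
  a common non-neighbour, that is, a common neighbour in $\overline{G}$. Then in $\overline{G}$
  the $k$ neighbours of a vertex in $G$ are at distance 2 and the other $n - 1 - k$ vertices
  are at distance 1, so every sum of distances is $2k + (n - 1 - k) = n - 1 + k$
  (lemma \<open>distance_spectral_radius_complement_regular\<close>).

  The graph $C_n(1,a)$ is 4-regular, since $1, a, n - a, n - 1$ are distinct. Two adjacent
  vertices $u, v$ lie in each other's neighbourhood, and the two neighbourhoods together have at
  most 8 elements, so they miss a vertex when $n \geq 9$. When $n = 8$ this count has no room to
  spare. For $a = 3$ the graph is $K_{4,4}$, whose complement is disconnected. For $a = 2$ every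
  edge lies in a triangle, so the two neighbourhoods overlap and cover at most 7 vertices.
\<close>

section \<open>Nonnegative matrices with constant row sums\<close>

text \<open>
  An eigenvector is bounded by its entry of largest absolute value, so that entry shows
  $|\lambda| \leq r$.
\<close>

lemma eigenvalue_le_row_sum:
  fixes A :: "real mat"
  assumes A: "A \<in> carrier_mat n n"
    and nonneg: "\<And>i j. i < n \<Longrightarrow> j < n \<Longrightarrow> 0 \<le> A $$ (i, j)"
    and row_sum: "\<And>i. i < n \<Longrightarrow> (\<Sum>j<n. A $$ (i, j)) = r"
    and ev: "eigenvalue A x"
  shows "x \<le> r"
proof -
  obtain v where v: "v \<in> carrier_vec n" "v \<noteq> 0\<^sub>v n" "A *\<^sub>v v = x \<cdot>\<^sub>v v"
    using ev A unfolding eigenvalue_def eigenvector_def by auto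
  obtain j where j: "j < n" "v $ j \<noteq> 0"
    using v(1,2) by (metis carrier_vecD eq_vecI index_zero_vec(1) index_zero_vec(2))
  define M where "M = Max ((\<lambda>i. \<bar>v $ i\<bar>) ` {..<n})"
  have le_M: "\<bar>v $ k\<bar> \<le> M" if "k < n" for k
    unfolding M_def using that by (intro Max_ge) auto
  have "M \<in> (\<lambda>i. \<bar>v $ i\<bar>) ` {..<n}"
    unfolding M_def using j(1) by (intro Max_in) auto
  then obtain i where i: "i < n" "\<bar>v $ i\<bar> = M"
    by auto
  have "M > 0"
    using le_M[OF j(1)] j(2) by auto
  have "x * v $ i = (A *\<^sub>v v) $ i"
    using v i(1) by simp
  also have "\<dots> = (\<Sum>k<n. A $$ (i, k) * v $ k)"
    using A v(1) i(1) by (simp add: scalar_prod_def atLeast0LessThan)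
  finally have "\<bar>x\<bar> * M = \<bar>\<Sum>k<n. A $$ (i, k) * v $ k\<bar>"
    using i(2) by (metis abs_mult)
  also have "\<dots> \<le> (\<Sum>k<n. \<bar>A $$ (i, k) * v $ k\<bar>)"
    by (rule sum_abs)
  also have "\<dots> \<le> (\<Sum>k<n. A $$ (i, k) * M)"
    using nonneg[OF i(1)] le_M by (intro sum_mono) (auto simp: abs_mult intro!: mult_left_mono)
  also have "\<dots> = r * M"
    using row_sum[OF i(1)] by (simp flip: sum_distrib_right)
  finally show ?thesis
    using \<open>M > 0\<close> by simp
qed

lemma Max_spectrum_eq_row_sum:
  fixes A :: "real mat"
  assumes A: "A \<in> carrier_mat n n" and "n > 0"
    and nonneg: "\<And>i j. i < n \<Longrightarrow> j < n \<Longrightarrow> 0 \<le> A $$ (i, j)"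
    and row_sum: "\<And>i. i < n \<Longrightarrow> (\<Sum>j<n. A $$ (i, j)) = r"
  shows "Max (spectrum A) = r"
proof (rule Max_eqI)
  show "finite (spectrum A)"
    using A by (rule card_finite_spectrum)
  show "x \<le> r" if "x \<in> spectrum A" for x
    using that eigenvalue_le_row_sum[OF A nonneg row_sum] by (simp add: spectrum_def)
  let ?ones = "vec n (\<lambda>_. 1) :: real vec"
  have "?ones \<noteq> 0\<^sub>v n"
    using \<open>n > 0\<close> by (metis index_vec index_zero_vec(1) zero_neq_one)
  moreover have "A *\<^sub>v ?ones = r \<cdot>\<^sub>v ?ones"
    using A row_sum by (intro eq_vecI) (auto simp: scalar_prod_def atLeast0LessThan)
  ultimately have "eigenvector A ?ones r"
    using A by (simp add: eigenvector_def)
  then show "r \<in> spectrum A"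
    by (auto simp: spectrum_def eigenvalue_def)
qed

lemma distance_spectral_radius_eq_distance_sum:
  assumes fin: "finite (pverts G)" and ne: "pverts G \<noteq> {}"
    and dist_sum: "\<And>u. u \<in> pverts G \<Longrightarrow> (\<Sum>v\<in>pverts G. real (graph_distance G u v)) = r"
  shows "distance_spectral_radius G = r"
proof -
  define vs where "vs = sorted_list_of_set (pverts G)"
  have vs: "set vs = pverts G" "distinct vs"
    using fin by (auto simp: vs_def)
  let ?n = "length vs"
  have D: "distance_matrix G = mat ?n ?n (\<lambda>(i, j). real (graph_distance G (vs ! i) (vs ! j)))"
    by (simp add: distance_matrix_def vs_def Let_def)
  have "(\<Sum>j<?n. distance_matrix G $$ (i, j)) = r" if "i < ?n" for i
  proof -
    have "(\<Sum>j<?n. distance_matrix G $$ (i, j)) =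
        (\<Sum>j<?n. real (graph_distance G (vs ! i) (vs ! j)))"
      using that by (simp add: D)
    also have "\<dots> = (\<Sum>v\<in>pverts G. real (graph_distance G (vs ! i) v))"
      using vs by (intro sum.reindex_bij_betw bij_betw_nth) auto
    finally show ?thesis
      using dist_sum that vs(1) nth_mem by metis
  qed
  moreover have "?n > 0"
    using vs(1) ne by auto
  ultimately show ?thesis
    unfolding distance_spectral_radius_def
    by (intro Max_spectrum_eq_row_sum[of _ ?n]) (auto simp: D)
qed

section \<open>Complements of regular graphs\<close>

lemma graph_distance_self:
  assumes "u \<in> pverts G"
  shows "graph_distance G u u = 0"
proof -
  interpret pair_pre_digraph G .
  have "apath u [] u"
    using assms by (simp add: apath_def awalk_def)
  then show ?thesis
    unfolding graph_distance_def by (intro Least_equality) auto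
qed

context pair_graph
begin

lemma graph_distance_arc:
  assumes arc: "(u, v) \<in> parcs G"
  shows "graph_distance G u v = 1"
proof -
  have "u \<noteq> v"
    using pair_no_loops[OF arc] by simp
  have "apath u [(u, v)] v"
    using arc \<open>u \<noteq> v\<close> by (auto simp: apath_simps wellformed')
  moreover have "1 \<le> length p" if "apath u p v" for p
    using that \<open>u \<noteq> v\<close> by (cases p) (auto simp: apath_Nil_iff)
  ultimately show ?thesis
    unfolding graph_distance_def by (intro Least_equality exI[of _ "[(u, v)]"]) auto
qed

lemma graph_distance_common_neighbour:
  assumes "u \<noteq> v" "(u, v) \<notin> parcs G" and arcs: "(u, w) \<in> parcs G" "(w, v) \<in> parcs G"
  shows "graph_distance G u v = 2"
proof -
  have "u \<noteq> w" "w \<noteq> v"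
    using arcs pair_no_loops by fastforce+
  then have "apath u [(u, w), (w, v)] v"
    using arcs \<open>u \<noteq> v\<close> by (auto simp: apath_simps wellformed')
  moreover have "2 \<le> length p" if p: "apath u p v" for p
  proof (rule ccontr)
    assume "\<not> 2 \<le> length p"
    then have "p = [] \<or> (\<exists>e. p = [e])"
      by (cases p; cases "tl p") auto
    then show False
      using p assms(1,2) by (auto simp: apath_simps)
  qed
  ultimately show ?thesis
    unfolding graph_distance_def by (intro Least_equality exI[of _ "[(u, w), (w, v)]"]) auto
qed

lemma connected_complement:
  assumes "pverts G \<noteq> {}"
    and common: "\<And>u v. (u, v) \<in> parcs G \<Longrightarrow>
      \<exists>w. (u, w) \<in> parcs (complement_graph G) \<and> (w, v) \<in> parcs (complement_graph G)"
  shows "Digraph_Component.connected (with_proj (complement_graph G))"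
proof -
  interpret C: pair_graph "complement_graph G"
    by (rule complement_graph_pair_graph) unfold_locales
  have "u \<rightarrow>\<^sup>*\<^bsub>with_proj (complement_graph G)\<^esub> v" if "u \<in> pverts G" "v \<in> pverts G" for u v
  proof (cases "u = v \<or> (u, v) \<in> parcs (complement_graph G)")
    case True
    then show ?thesis
    proof
      assume "u = v"
      moreover have "u \<in> pverts (complement_graph G)"
        using that(1) by (simp add: complement_graph_def)
      ultimately show ?thesis
        by simp
    qed (rule C.reachable_adjI)
  next
    case False
    then have "(u, v) \<in> parcs G"
      using that by (auto simp: complement_graph_def)
    from common[OF this] show ?thesis
      by (meson C.reachable_adjI C.reachable_trans)
  qed
  then show ?thesis
    unfolding Digraph_Component.connected_def strongly_connected_def
    using assms(1) C.reachable_mk_symmetricI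
    by (auto simp: complement_graph_def mk_symmetric_def)
qed

text \<open>
  Under the hypothesis on common neighbours the complement has diameter 2, so that distances in
  it only depend on adjacency in \<open>G\<close>.
\<close>

lemma distance_sum_complement:
  assumes u: "u \<in> pverts G"
    and common: "\<And>v. (u, v) \<in> parcs G \<Longrightarrow>
      \<exists>w. (u, w) \<in> parcs (complement_graph G) \<and> (w, v) \<in> parcs (complement_graph G)"
  shows "(\<Sum>v\<in>pverts G. real (graph_distance (complement_graph G) u v)) =
    real (card (pverts G)) - 1 + real (card {v. (u, v) \<in> parcs G})"
proof -
  interpret C: pair_graph "complement_graph G"
    by (rule complement_graph_pair_graph) unfold_locales
  have V: "pverts (complement_graph G) = pverts G"
    by (simp add: complement_graph_def)
  let ?N = "{v. (u, v) \<in> parcs G}"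
  have N: "?N \<subseteq> pverts G" "u \<notin> ?N"
    using wellformed' pair_no_loops by fastforce+
  have dist: "real (graph_distance (complement_graph G) u v) =
      1 + of_bool (v \<in> ?N) - of_bool (v = u)" if v: "v \<in> pverts G" for v
  proof -
    consider "v = u" | "v \<noteq> u" "v \<in> ?N" | "v \<noteq> u" "v \<notin> ?N"
      by blast
    then show ?thesis
    proof cases
      case 1
      then show ?thesis
        using u N(2) by (simp add: graph_distance_self V)
    next
      case 2
      then obtain w where "(u, w) \<in> parcs (complement_graph G)"
          "(w, v) \<in> parcs (complement_graph G)"
        using common by blast
      moreover have "(u, v) \<notin> parcs (complement_graph G)"
        using 2 by (simp add: complement_graph_def)
      ultimately have "graph_distance (complement_graph G) u v = 2"
        using 2(1) by (metis C.graph_distance_common_neighbour)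
      then show ?thesis
        using 2 by simp
    next
      case 3
      then have "(u, v) \<in> parcs (complement_graph G)"
        using u v by (simp add: complement_graph_def)
      then show ?thesis
        using 3 by (simp add: C.graph_distance_arc)
    qed
  qed
  have "(\<Sum>v\<in>pverts G. real (graph_distance (complement_graph G) u v)) =
      (\<Sum>v\<in>pverts G. 1 + of_bool (v \<in> ?N) - of_bool (v = u))"
    using dist by (rule sum.cong[OF refl])
  also have "\<dots> = real (card (pverts G)) + real (card (pverts G \<inter> ?N)) -
      real (card (pverts G \<inter> {v. v = u}))"
    using pair_finite_verts by (simp add: sum.distrib sum_subtractf sum_of_bool_eq)
  also have "pverts G \<inter> {v. v = u} = {u}"
    using u by auto
  also have "pverts G \<inter> ?N = ?N"
    using N(1) by auto
  finally show ?thesis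
    by simp
qed

text \<open>
  The endpoints of an edge have a common non-neighbour unless their neighbourhoods cover the whole
  graph, which is excluded by counting.
\<close>

lemma common_neighbour_complement:
  assumes uv: "(u, v) \<in> parcs G"
    and count: "card {w. (u, w) \<in> parcs G} + card {w. (v, w) \<in> parcs G} <
      card (pverts G) + card ({w. (u, w) \<in> parcs G} \<inter> {w. (v, w) \<in> parcs G})"
  shows "\<exists>w. (u, w) \<in> parcs (complement_graph G) \<and> (w, v) \<in> parcs (complement_graph G)"
proof -
  let ?N = "\<lambda>u. {w. (u, w) \<in> parcs G}"
  have vu: "(v, u) \<in> parcs G"
    using uv by (rule arcs_symmetric)
  have u: "u \<in> pverts G" and v: "v \<in> pverts G"
    using uv wellformed' by auto
  have fin: "finite (?N x)" for x
    using wellformed' by (intro finite_subset[OF _ pair_finite_verts]) auto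
  have "card (?N u \<union> ?N v) < card (pverts G)"
    using card_Un_Int[OF fin[of u] fin[of v]] count by linarith
  then have "\<not> pverts G \<subseteq> ?N u \<union> ?N v"
    using fin by (meson card_mono finite_UnI linorder_not_le)
  then obtain w where w: "w \<in> pverts G" "w \<notin> ?N u \<union> ?N v"
    by blast
  moreover have "(w, v) \<notin> parcs G"
    using w(2) arcs_symmetric by auto
  \<comment> \<open>Since \<open>u\<close> and \<open>v\<close> are adjacent, each of them lies in the neighbourhood of the other.\<close>
  moreover have "w \<noteq> u" "w \<noteq> v"
    using w(2) uv vu by auto
  ultimately show ?thesis
    using u v by (auto simp: complement_graph_def)
qed

end

lemma distance_spectral_radius_complement_regular:
  assumes G: "pair_graph G" and ne: "pverts G \<noteq> {}"
    and regular: "\<And>u. u \<in> pverts G \<Longrightarrow> card {v. (u, v) \<in> parcs G} = k"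
    and common: "\<And>u v. (u, v) \<in> parcs G \<Longrightarrow>
      \<exists>w. (u, w) \<in> parcs (complement_graph G) \<and> (w, v) \<in> parcs (complement_graph G)"
  shows "distance_spectral_radius (complement_graph G) = real (card (pverts G)) - 1 + real k"
proof -
  interpret pair_graph G by fact
  have "pverts (complement_graph G) = pverts G"
    by (simp add: complement_graph_def)
  then show ?thesis
    using ne pair_finite_verts distance_sum_complement[OF _ common] regular
    by (intro distance_spectral_radius_eq_distance_sum) simp_all
qed

section \<open>The circulant graphs with connection set $\{1, a\}$\<close>

lemma circulant_arc_iff:
  assumes "u < n" "v < n"
  shows "(u, v) \<in> parcs (circulant_graph n S) \<longleftrightarrow>
    (\<exists>s\<in>S. v = (u + s) mod n \<or> u = (v + s) mod n)"
  using assms by (auto simp: circulant_graph_def circulant_edges_def doubleton_eq_iff)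

lemma mod_add_eq_iff_sub:
  fixes u v n s :: nat
  assumes "u < n" "v < n" "s \<le> n"
  shows "u = (v + s) mod n \<longleftrightarrow> v = (u + (n - s)) mod n"
  using assms by (auto simp: mod_if not_less)

lemma circulant_neighbours:
  assumes S: "S \<subseteq> {1..<n}" and u: "u < n"
  shows "{v. (u, v) \<in> parcs (circulant_graph n S)} =
    (\<lambda>s. (u + s) mod n) ` (S \<union> (\<lambda>s. n - s) ` S)"
proof -
  interpret pair_graph "circulant_graph n S"
    using S by (rule circulant_graph_pair_graph)
  have lt: "v < n" if "(u, v) \<in> parcs (circulant_graph n S)" for v
    using in_arcsD2[OF that] by (simp add: circulant_graph_def)
  have "s \<le> n" if "s \<in> S" for s
    using S that by auto
  then have "(u, v) \<in> parcs (circulant_graph n S) \<longleftrightarrow>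
      (\<exists>s\<in>S. v = (u + s) mod n \<or> v = (u + (n - s)) mod n)" if "v < n" for v
    using u that by (simp add: circulant_arc_iff mod_add_eq_iff_sub[OF u that] cong: bex_cong)
  then show ?thesis
    using lt u by (force simp: image_iff)
qed

lemma circulant_regular:
  assumes S: "S \<subseteq> {1..<n}" and u: "u < n"
  shows "card {v. (u, v) \<in> parcs (circulant_graph n S)} = card (S \<union> (\<lambda>s. n - s) ` S)"
proof -
  have "inj_on (\<lambda>s. (u + s) mod n) {..<n}"
    using u by (intro inj_onI) (auto simp: mod_if split: if_splits)
  moreover have "S \<union> (\<lambda>s. n - s) ` S \<subseteq> {..<n}"
    using S u by auto
  ultimately show ?thesis
    unfolding circulant_neighbours[OF assms] by (intro card_image) (rule inj_on_subset)
qed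

text \<open>
  The vertices \<open>x\<close>, \<open>x + 1\<close>, \<open>x + 2\<close> form a triangle, and every edge of $C_n(1,2)$ lies in such a
  triangle.
\<close>

lemma circulant_1_2_common_neighbour:
  assumes n: "2 < n" and uv: "(u, v) \<in> parcs (circulant_graph n {1, 2})"
  shows "\<exists>w. (u, w) \<in> parcs (circulant_graph n {1, 2}) \<and> (v, w) \<in> parcs (circulant_graph n {1, 2})"
proof -
  have S: "{1, 2} \<subseteq> {1..<n}"
    using n by auto
  interpret pair_graph "circulant_graph n {1, 2}"
    using S by (rule circulant_graph_pair_graph)
  have lt: "u < n" "v < n"
    using wellformed'[OF uv] by (auto simp: circulant_graph_def)
  have triangle: "\<exists>w. (x, w) \<in> parcs (circulant_graph n {1, 2}) \<and>
      (y, w) \<in> parcs (circulant_graph n {1, 2})"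
    if "x < n" "y = (x + 1) mod n \<or> y = (x + 2) mod n" for x y
    using that(2)
  proof
    assume y: "y = (x + 1) mod n"
    have "(x + 2) mod n = (y + 1) mod n"
      unfolding y by (simp add: mod_simps)
    moreover have "y < n" "(x + 2) mod n < n"
      using n y by auto
    ultimately show ?thesis
      using that(1) by (intro exI[of _ "(x + 2) mod n"]) (simp add: circulant_arc_iff)
  next
    assume y: "y = (x + 2) mod n"
    have "y = ((x + 1) mod n + 1) mod n"
      unfolding y by (simp add: mod_simps)
    moreover have "y < n" "(x + 1) mod n < n"
      using n y by auto
    ultimately show ?thesis
      using that(1) by (intro exI[of _ "(x + 1) mod n"]) (simp add: circulant_arc_iff)
  qed
  have "(v = (u + 1) mod n \<or> v = (u + 2) mod n) \<or> (u = (v + 1) mod n \<or> u = (v + 2) mod n)"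
    using uv lt by (auto simp: circulant_arc_iff)
  then show ?thesis
    using triangle lt by blast
qed

theorem theorem4p5:
  fixes n a :: nat
  assumes "n \<ge> 8"
    and "2 \<le> a" and "real a < real n / 2"
    and "(n, a) \<noteq> (8, 3)"
  shows "Digraph_Component.connected (with_proj (complement_graph (circulant_graph n {1, a}))) \<and>
         distance_spectral_radius (complement_graph (circulant_graph n {1, a})) = real n + 3"
proof -
  let ?G = "circulant_graph n {1, a}"
  have a: "2 * a < n"
    using assms(3) by simp
  then have S: "{1, a} \<subseteq> {1..<n}"
    using assms(2) by auto
  interpret pair_graph ?G
    using S by (rule circulant_graph_pair_graph)
  have V: "pverts (circulant_graph n T) = {0..<n}" for T
    by (simp add: circulant_graph_def)
  have "distinct [1, a, n - 1, n - a]"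
    using assms(2) a by auto
  from distinct_card[OF this] have "card ({1, a} \<union> (\<lambda>s. n - s) ` {1, a}) = 4"
    by (simp add: insert_commute)
  then have regular: "card {v. (u, v) \<in> parcs ?G} = 4" if "u \<in> pverts ?G" for u
    using circulant_regular[OF S] that by (simp add: V)
  have common: "\<exists>w. (u, w) \<in> parcs (complement_graph ?G) \<and> (w, v) \<in> parcs (complement_graph ?G)"
    if uv: "(u, v) \<in> parcs ?G" for u v
  proof (rule common_neighbour_complement[OF uv])
    let ?N = "\<lambda>u. {w. (u, w) \<in> parcs ?G}"
    have "8 < n + card (?N u \<inter> ?N v)"
    proof (cases "n = 8")
      case True
      then have "a = 2"
        using a assms(2,4) by auto
      then have "?N u \<inter> ?N v \<noteq> {}"
        using circulant_1_2_common_neighbour[of n u v] True uv by auto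
      moreover have "finite (?N u \<inter> ?N v)"
        using wellformed' by (intro finite_subset[OF _ pair_finite_verts]) auto
      ultimately show ?thesis
        using True by (simp add: card_gt_0_iff)
    next
      case False
      then show ?thesis
        using assms(1) by simp
    qed
    then show "card (?N u) + card (?N v) < card (pverts ?G) + card (?N u \<inter> ?N v)"
      using regular wellformed'[OF uv] by (simp add: V)
  qed
  have "pverts ?G \<noteq> {}"
    using assms(1) by (simp add: V)
  then show ?thesis
    using connected_complement[OF _ common] distance_spectral_radius_complement_regular[OF pair_graph_axioms _ regular common]
    by (simp add: V)
qed

end
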